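(* Let $X$ be a connected based space having the based homotopy type of a CW-complex. For each positive integer $n$, the quotient group $\mathcal{E}(X)/\mathcal{E}_\sharp^n(X)$ is isomorphic to a subgroup of the monoid $\bar{\mathcal{A}}_\sharp^n(X)$ (that is, to a submonoid which is a group). In particular, if $N\mathcal{E}(X)=n$, then $\bar{\mathcal{A}}_\sharp^n(X)\cong\mathcal{E}(X)/\mathcal{E}_\sharp^n(X)$.
   Context: All maps and homotopies preserve base points. $[X,X]$ is the monoid (under composition) of based homotopy classes of based self-maps of $X$, and $\mathcal{E}(X)\subseteq[X,X]$ is the group of classes of self-homotopy equivalences. For a nonnegative integer $k$, $\mathcal{A}_\sharp^k(X)\subseteq[X,X]$ is the submonoid of classes $f$ such that $\pi_i(f):\pi_i(X)\to\pi_i(X)$ is an isomorphism for all $i=0,1,\dots,k$. The self-closeness number is $N\mathcal{E}(X)=\min\{k\geq 0 : \mathcal{A}_\sharp^k(X)=\mathcal{E}(X)\}$, with $N\mathcal{E}(X)=\infty$ if no such nonnegative integer $k$ exists. $\mathcal{E}_\sharp^n(X)=\{f\in\mathcal{E}(X) : \pi_i(f)=\mathrm{id}_{\pi_i(X)}\text{ for } i=0,\dots,n\}$, a normal subgroup of $\mathcal{E}(X)$. On $\mathcal{A}_\sharp^n(X)$ define the equivalence relation $f\simeq_n g$ iff $\pi_i(f)=\pi_i(g)$ for $i=0,\dots,n$; write $\bar f$ for the class of $f$ and $\bar{\mathcal{A}}_\sharp^n(X)$ for the set of classes, which is a monoid under $\bar f\cdot\bar g=\overline{f\circ g}$ with identity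 $\overline{\mathrm{id}_X}$. *)

theory Defs
  imports "HOL-Analysis.Analysis" "HOL-Algebra.Coset" "HOL-Library.Extended_Nat"
begin

text \<open>
  A based space is a topology \<open>X\<close> with a point \<open>x\<close> of its carrier. Continuous maps are HOL
  functions whose values off \<open>topspace X\<close> are arbitrary; \<open>homotopic_with\<close> ignores these values
  for the properties used below, so homotopy classes do not depend on them.
\<close>

section \<open>Based maps and based homotopy\<close>

definition based_maps :: "'a topology \<Rightarrow> 'a \<Rightarrow> 'b topology \<Rightarrow> 'b \<Rightarrow> ('a \<Rightarrow> 'b) set" where
  "based_maps X x Y y = {f. continuous_map X Y f \<and> f x = y}"

definition based_homotopic ::
    "'a topology \<Rightarrow> 'a \<Rightarrow> 'b topology \<Rightarrow> 'b \<Rightarrow> ('a \<Rightarrow> 'b) \<Rightarrow> ('a \<Rightarrow> 'b) \<Rightarrow> bool" where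
  "based_homotopic X x Y y = homotopic_with (\<lambda>h. h x = y) X Y"

definition based_homotopy_rel ::
    "'a topology \<Rightarrow> 'a \<Rightarrow> 'b topology \<Rightarrow> 'b \<Rightarrow> (('a \<Rightarrow> 'b) \<times> ('a \<Rightarrow> 'b)) set" where
  "based_homotopy_rel X x Y y = {(f, g). based_homotopic X x Y y f g}"

definition based_homotopy_equivalence ::
    "'a topology \<Rightarrow> 'a \<Rightarrow> 'b topology \<Rightarrow> 'b \<Rightarrow> ('a \<Rightarrow> 'b) \<Rightarrow> bool" where
  "based_homotopy_equivalence X x Y y f \<longleftrightarrow>
     f \<in> based_maps X x Y y \<and>
     (\<exists>g \<in> based_maps Y y X x.
        based_homotopic X x X x (g \<circ> f) id \<and> based_homotopic Y y Y y (f \<circ> g) id)"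

definition based_homotopy_equivalent ::
    "'a topology \<Rightarrow> 'a \<Rightarrow> 'b topology \<Rightarrow> 'b \<Rightarrow> bool" where
  "based_homotopy_equivalent X x Y y \<longleftrightarrow> (\<exists>f. based_homotopy_equivalence X x Y y f)"


section \<open>CW-complexes\<close>

definition disc :: "nat \<Rightarrow> (nat \<Rightarrow> real) set" where
  "disc n = {s \<in> topspace (Euclidean_space n). (\<Sum>i<n. (s i)\<^sup>2) \<le> 1}"

definition open_disc :: "nat \<Rightarrow> (nat \<Rightarrow> real) set" where
  "open_disc n = {s \<in> topspace (Euclidean_space n). (\<Sum>i<n. (s i)\<^sup>2) < 1}"

definition disc_boundary :: "nat \<Rightarrow> (nat \<Rightarrow> real) set" where
  "disc_boundary n = disc n - open_disc n"

text \<open>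
  A CW-structure is given by a set \<open>C\<close> of pairs \<open>(n, \<phi>)\<close>, one for each cell, where \<open>n\<close> is the
  dimension of the cell and \<open>\<phi>\<close> its characteristic map. The conditions are those of J. H. C.
  Whitehead: the open cells partition the Hausdorff space \<open>X\<close>, the boundary of each cell lies in
  finitely many cells of smaller dimension, and \<open>X\<close> has the weak topology with respect to the
  closures of the cells.
\<close>

definition CW_structure :: "'a topology \<Rightarrow> (nat \<times> ((nat \<Rightarrow> real) \<Rightarrow> 'a)) set \<Rightarrow> bool" where
  "CW_structure X C \<longleftrightarrow>
     Hausdorff_space X \<and>
     (\<forall>(n, \<phi>) \<in> C.
        continuous_map (subtopology (Euclidean_space n) (disc n)) X \<phi> \<and>
        homeomorphic_map (subtopology (Euclidean_space n) (open_disc n))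
                         (subtopology X (\<phi> ` open_disc n)) \<phi>) \<and>
     pairwise (\<lambda>(n, \<phi>) (m, \<psi>). disjnt (\<phi> ` open_disc n) (\<psi> ` open_disc m)) C \<and>
     (\<Union>(n, \<phi>) \<in> C. \<phi> ` open_disc n) = topspace X \<and>
     (\<forall>(n, \<phi>) \<in> C. \<exists>F \<subseteq> C. finite F \<and> (\<forall>(m, \<psi>) \<in> F. m < n) \<and>
        \<phi> ` disc_boundary n \<subseteq> (\<Union>(m, \<psi>) \<in> F. \<psi> ` open_disc m)) \<and>
     (\<forall>A \<subseteq> topspace X.
        closedin X A \<longleftrightarrow>
        (\<forall>(n, \<phi>) \<in> C. closedin X (A \<inter> X closure_of (\<phi> ` open_disc n))))"

definition CW_complex :: "'a topology \<Rightarrow> bool" where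
  "CW_complex X \<longleftrightarrow> (\<exists>C. CW_structure X C)"


section \<open>Homotopy groups\<close>

definition cube :: "nat \<Rightarrow> (nat \<Rightarrow> real) topology" where
  "cube n = subtopology (Euclidean_space n) {s. \<forall>i<n. 0 \<le> s i \<and> s i \<le> 1}"

definition cube_boundary :: "nat \<Rightarrow> (nat \<Rightarrow> real) set" where
  "cube_boundary n = {s \<in> topspace (cube n). \<exists>i<n. s i = 0 \<or> s i = 1}"

definition cube_maps :: "nat \<Rightarrow> 'a topology \<Rightarrow> 'a \<Rightarrow> ((nat \<Rightarrow> real) \<Rightarrow> 'a) set" where
  "cube_maps n X x = {f. continuous_map (cube n) X f \<and> (\<forall>s \<in> cube_boundary n. f s = x)}"

definition cube_homotopy_rel ::
    "nat \<Rightarrow> 'a topology \<Rightarrow> 'a \<Rightarrow> (((nat \<Rightarrow> real) \<Rightarrow> 'a) \<times> ((nat \<Rightarrow> real) \<Rightarrow> 'a)) set" where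
  "cube_homotopy_rel n X x =
     {(f, g). homotopic_with (\<lambda>h. \<forall>s \<in> cube_boundary n. h s = x) (cube n) X f g}"

text \<open>
  Since \<open>cube 0\<close> is a point with empty boundary, \<open>homotopy_set 0 X x\<close> is the set of path
  components of \<open>X\<close>.
\<close>

definition homotopy_set :: "nat \<Rightarrow> 'a topology \<Rightarrow> 'a \<Rightarrow> ((nat \<Rightarrow> real) \<Rightarrow> 'a) set set" where
  "homotopy_set n X x = cube_maps n X x // cube_homotopy_rel n X x"

definition cube_concat ::
    "((nat \<Rightarrow> real) \<Rightarrow> 'a) \<Rightarrow> ((nat \<Rightarrow> real) \<Rightarrow> 'a) \<Rightarrow> (nat \<Rightarrow> real) \<Rightarrow> 'a" where
  "cube_concat f g = (\<lambda>s. if s 0 \<le> 1/2 then f (s(0 := 2 * s 0)) else g (s(0 := 2 * s 0 - 1)))"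

text \<open>Meaningful for \<open>n \<ge> 1\<close> only; \<open>\<pi>\<^sub>0\<close> is used merely as a set.\<close>

definition homotopy_group ::
    "nat \<Rightarrow> 'a topology \<Rightarrow> 'a \<Rightarrow> ((nat \<Rightarrow> real) \<Rightarrow> 'a) set monoid" where
  "homotopy_group n X x =
     \<lparr>carrier = homotopy_set n X x,
      mult = (\<lambda>a b. \<Union>f \<in> a. \<Union>g \<in> b. cube_homotopy_rel n X x `` {cube_concat f g}),
      one = cube_homotopy_rel n X x `` {\<lambda>s. x}\<rparr>"


section \<open>The monoid of homotopy classes of self-maps\<close>

definition self_map_monoid :: "'a topology \<Rightarrow> 'a \<Rightarrow> ('a \<Rightarrow> 'a) set monoid" where
  "self_map_monoid X x =
     \<lparr>carrier = based_maps X x X x // based_homotopy_rel X x X x,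
      mult = (\<lambda>F G. \<Union>f \<in> F. \<Union>g \<in> G. based_homotopy_rel X x X x `` {f \<circ> g}),
      one = based_homotopy_rel X x X x `` {id}\<rparr>"

text \<open>The map induced on \<open>\<pi>\<^sub>i\<close> by a homotopy class \<open>F\<close> of self-maps.\<close>

definition homotopy_induced ::
    "nat \<Rightarrow> 'a topology \<Rightarrow> 'a \<Rightarrow> ('a \<Rightarrow> 'a) set \<Rightarrow>
     ((nat \<Rightarrow> real) \<Rightarrow> 'a) set \<Rightarrow> ((nat \<Rightarrow> real) \<Rightarrow> 'a) set" where
  "homotopy_induced i X x F =
     (\<lambda>c \<in> homotopy_set i X x. \<Union>f \<in> F. \<Union>h \<in> c. cube_homotopy_rel i X x `` {f \<circ> h})"

definition homotopy_induced_iso :: "nat \<Rightarrow> 'a topology \<Rightarrow> 'a \<Rightarrow> ('a \<Rightarrow> 'a) set \<Rightarrow> bool" where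
  "homotopy_induced_iso i X x F \<longleftrightarrow>
     (if i = 0
      then bij_betw (homotopy_induced 0 X x F) (homotopy_set 0 X x) (homotopy_set 0 X x)
      else homotopy_induced i X x F \<in> iso (homotopy_group i X x) (homotopy_group i X x))"

definition self_equivalences :: "'a topology \<Rightarrow> 'a \<Rightarrow> ('a \<Rightarrow> 'a) set set" where
  "self_equivalences X x =
     {f. based_homotopy_equivalence X x X x f} // based_homotopy_rel X x X x"

definition self_equivalence_group :: "'a topology \<Rightarrow> 'a \<Rightarrow> ('a \<Rightarrow> 'a) set monoid" where
  "self_equivalence_group X x = (self_map_monoid X x)\<lparr>carrier := self_equivalences X x\<rparr>"

definition A_sharp :: "nat \<Rightarrow> 'a topology \<Rightarrow> 'a \<Rightarrow> ('a \<Rightarrow> 'a) set set" where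
  "A_sharp k X x = {F \<in> carrier (self_map_monoid X x). \<forall>i\<le>k. homotopy_induced_iso i X x F}"

definition self_closeness_number :: "'a topology \<Rightarrow> 'a \<Rightarrow> enat" where
  "self_closeness_number X x =
     (if \<exists>k. A_sharp k X x = self_equivalences X x
      then enat (LEAST k. A_sharp k X x = self_equivalences X x)
      else \<infinity>)"

definition E_sharp :: "nat \<Rightarrow> 'a topology \<Rightarrow> 'a \<Rightarrow> ('a \<Rightarrow> 'a) set set" where
  "E_sharp n X x =
     {F \<in> self_equivalences X x. \<forall>i\<le>n. \<forall>c \<in> homotopy_set i X x. homotopy_induced i X x F c = c}"

definition A_sharp_rel ::
    "nat \<Rightarrow> 'a topology \<Rightarrow> 'a \<Rightarrow> (('a \<Rightarrow> 'a) set \<times> ('a \<Rightarrow> 'a) set) set" where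
  "A_sharp_rel n X x =
     {(F, G). F \<in> A_sharp n X x \<and> G \<in> A_sharp n X x \<and>
        (\<forall>i\<le>n. homotopy_induced i X x F = homotopy_induced i X x G)}"

definition A_sharp_bar :: "nat \<Rightarrow> 'a topology \<Rightarrow> 'a \<Rightarrow> ('a \<Rightarrow> 'a) set set monoid" where
  "A_sharp_bar n X x =
     \<lparr>carrier = A_sharp n X x // A_sharp_rel n X x,
      mult = (\<lambda>a b. \<Union>F \<in> a. \<Union>G \<in> b. A_sharp_rel n X x `` {F \<otimes>\<^bsub>self_map_monoid X x\<^esub> G}),
      one = A_sharp_rel n X x `` {\<one>\<^bsub>self_map_monoid X x\<^esub>}\<rparr>"

end

theory Submission
  imports Defs
begin

text \<open>
  Passing to induced maps on the homotopy groups up to degree \<open>n\<close> sends the group of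
  self-equivalences to the quotient monoid of \<open>A_sharp n X x\<close>. This is a homomorphism, its
  kernel is \<open>E_sharp n X x\<close> by definition, and so the first isomorphism theorem identifies the
  quotient group with the image \<open>H\<close>, which is a submonoid that is a group. If the
  self-closeness number is \<open>n\<close>, then every element of \<open>A_sharp n X x\<close> is a self-equivalence,
  so \<open>H\<close> is everything.

  What carries this argument is that the objects involved are what their names promise. The
  self-equivalences are exactly the units of the monoid of homotopy classes
  (\<open>self_equivalences_eq_Units\<close>), hence a group. The induced maps are functorial
  (\<open>homotopy_induced_mult\<close>, \<open>homotopy_induced_one\<close>), so a unit induces a bijection in every
  degree. In positive degrees induced maps are homomorphisms (\<open>homotopy_induced_hom\<close>), because
  composition with a map commutes with concatenation of cubes. Hence being an isomorphism means
  being bijective in every degree, including degree \<open>0\<close>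
  (\<open>homotopy_induced_iso_iff_bij_betw\<close>). This gives both the inclusion of the self-equivalences
  in \<open>A_sharp n X x\<close> and the closure of \<open>A_sharp n X x\<close> under multiplication. Since
  every multiplication involved is a union over representatives, each use of it rests on its
  independence of the representatives. For homotopy groups this is the continuity of a
  concatenation of homotopies (\<open>continuous_map_cube_concat\<close>).
\<close>

section \<open>Homotopy classes of self-maps\<close>

abbreviation map_class :: "'a topology \<Rightarrow> 'a \<Rightarrow> ('a \<Rightarrow> 'a) \<Rightarrow> ('a \<Rightarrow> 'a) set" where
  "map_class X x f \<equiv> based_homotopy_rel X x X x `` {f}"

abbreviation cube_class ::
    "nat \<Rightarrow> 'a topology \<Rightarrow> 'a \<Rightarrow> ((nat \<Rightarrow> real) \<Rightarrow> 'a) \<Rightarrow> ((nat \<Rightarrow> real) \<Rightarrow> 'a) set" where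
  "cube_class i X x h \<equiv> cube_homotopy_rel i X x `` {h}"

lemma equiv_based_homotopy_rel: "equiv (based_maps X x Y y) (based_homotopy_rel X x Y y)"
proof (rule equivI)
  show "based_homotopy_rel X x Y y \<subseteq> based_maps X x Y y \<times> based_maps X x Y y"
    by (auto simp: based_homotopy_rel_def based_homotopic_def based_maps_def
        dest: homotopic_with_imp_continuous_maps homotopic_with_imp_property)
  show "refl_on (based_maps X x Y y) (based_homotopy_rel X x Y y)"
    by (auto simp: refl_on_def based_homotopy_rel_def based_homotopic_def based_maps_def)
  show "sym (based_homotopy_rel X x Y y)"
    by (auto simp: sym_def based_homotopy_rel_def based_homotopic_def intro: homotopic_with_symD)
  show "trans (based_homotopy_rel X x Y y)"
    by (auto simp: trans_def based_homotopy_rel_def based_homotopic_def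
        elim: homotopic_with_trans)
qed

lemma based_maps_compose:
  "f \<in> based_maps Y y Z z \<Longrightarrow> g \<in> based_maps X x Y y \<Longrightarrow> f \<circ> g \<in> based_maps X x Z z"
  by (auto simp: based_maps_def intro: continuous_map_compose)

lemma id_in_based_maps: "id \<in> based_maps X x X x"
  by (simp add: based_maps_def)

text \<open>
  The two factors are deformed one at a time, through \<open>f \<circ> g'\<close>.
\<close>

lemma based_homotopy_rel_compose:
  assumes ff': "(f, f') \<in> based_homotopy_rel Y y Z z"
    and gg': "(g, g') \<in> based_homotopy_rel X x Y y"
  shows "(f \<circ> g, f' \<circ> g') \<in> based_homotopy_rel X x Z z"
proof -
  have f: "f \<in> based_maps Y y Z z" and g': "g' \<in> based_maps X x Y y"
    using subsetD[OF equiv_type[OF equiv_based_homotopy_rel] ff']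
      subsetD[OF equiv_type[OF equiv_based_homotopy_rel] gg'] by auto
  have "homotopic_with (\<lambda>h. h x = z) X Z (f \<circ> g) (f \<circ> g')"
    by (rule homotopic_with_compose_continuous_map_left[where p = "\<lambda>h. h x = y" and ?X2.0 = Y])
       (use f gg' in \<open>auto simp: based_homotopy_rel_def based_homotopic_def based_maps_def\<close>)
  moreover have "homotopic_with (\<lambda>h. h x = z) X Z (f \<circ> g') (f' \<circ> g')"
    by (rule homotopic_with_compose_continuous_map_right[where p = "\<lambda>h. h y = z" and ?X2.0 = Y])
       (use g' ff' in \<open>auto simp: based_homotopy_rel_def based_homotopic_def based_maps_def\<close>)
  ultimately show ?thesis
    by (auto simp: based_homotopy_rel_def based_homotopic_def elim: homotopic_with_trans)
qed

lemma map_class_eq_iff: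
  "f \<in> based_maps X x X x \<Longrightarrow> g \<in> based_maps X x X x \<Longrightarrow>
     map_class X x f = map_class X x g \<longleftrightarrow> based_homotopic X x X x f g"
  by (simp add: eq_equiv_class_iff[OF equiv_based_homotopy_rel])
     (simp add: based_homotopy_rel_def)

lemma map_class_in_carrier:
  "f \<in> based_maps X x X x \<Longrightarrow> map_class X x f \<in> carrier (self_map_monoid X x)"
  by (simp add: self_map_monoid_def quotientI)

lemma carrier_self_map_monoid:
  "carrier (self_map_monoid X x) = map_class X x ` based_maps X x X x"
  by (auto simp: self_map_monoid_def quotient_def)

lemma self_map_monoid_cases:
  assumes "F \<in> carrier (self_map_monoid X x)"
  obtains f where "f \<in> based_maps X x X x" "F = map_class X x f"
  using assms unfolding self_map_monoid_def by (auto elim: quotientE)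

lemma map_class_mult:
  assumes "f \<in> based_maps X x X x" "g \<in> based_maps X x X x"
  shows "map_class X x f \<otimes>\<^bsub>self_map_monoid X x\<^esub> map_class X x g = map_class X x (f \<circ> g)"
proof -
  have "congruent2 (based_homotopy_rel X x X x) (based_homotopy_rel X x X x)
          (\<lambda>f g. map_class X x (f \<circ> g))"
    by (rule congruent2I')
       (rule equiv_class_eq[OF equiv_based_homotopy_rel], rule based_homotopy_rel_compose)
  from UN_equiv_class2[OF equiv_based_homotopy_rel equiv_based_homotopy_rel this assms]
  show ?thesis by (simp add: self_map_monoid_def)
qed

lemma map_class_one: "\<one>\<^bsub>self_map_monoid X x\<^esub> = map_class X x id"
  by (simp add: self_map_monoid_def)

lemma monoid_self_map_monoid: "monoid (self_map_monoid X x)"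
proof (rule monoidI)
  let ?M = "self_map_monoid X x"
  show "F \<otimes>\<^bsub>?M\<^esub> G \<in> carrier ?M" if "F \<in> carrier ?M" "G \<in> carrier ?M" for F G
    using that
    by (auto elim!: self_map_monoid_cases
        simp: map_class_mult intro!: map_class_in_carrier based_maps_compose)
  show "\<one>\<^bsub>?M\<^esub> \<in> carrier ?M"
    by (simp add: map_class_one map_class_in_carrier id_in_based_maps)
  show "F \<otimes>\<^bsub>?M\<^esub> G \<otimes>\<^bsub>?M\<^esub> H = F \<otimes>\<^bsub>?M\<^esub> (G \<otimes>\<^bsub>?M\<^esub> H)"
    if "F \<in> carrier ?M" "G \<in> carrier ?M" "H \<in> carrier ?M" for F G H
    using that
    by (auto elim!: self_map_monoid_cases simp: map_class_mult based_maps_compose comp_assoc)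
  show "\<one>\<^bsub>?M\<^esub> \<otimes>\<^bsub>?M\<^esub> F = F" "F \<otimes>\<^bsub>?M\<^esub> \<one>\<^bsub>?M\<^esub> = F" if "F \<in> carrier ?M" for F
    using that
    by (auto elim!: self_map_monoid_cases simp: map_class_mult map_class_one id_in_based_maps)
qed

text \<open>
  A homotopy inverse of \<open>f\<close> is the same as a representative of an inverse of the class of \<open>f\<close>.
  In particular, being an equivalence depends on the homotopy class only.
\<close>

lemma self_equivalences_eq_Units: "self_equivalences X x = Units (self_map_monoid X x)"
proof -
  let ?M = "self_map_monoid X x"
  have unit_iff: "map_class X x f \<in> Units ?M \<longleftrightarrow> based_homotopy_equivalence X x X x f"
    if f: "f \<in> based_maps X x X x" for f
  proof -
    have "map_class X x f \<in> Units ?M \<longleftrightarrow>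
        (\<exists>g \<in> based_maps X x X x. map_class X x (g \<circ> f) = map_class X x id \<and>
           map_class X x (f \<circ> g) = map_class X x id)"
      using f by (simp add: Units_def map_class_one carrier_self_map_monoid map_class_mult
          cong: bex_cong)
    also have "\<dots> \<longleftrightarrow> based_homotopy_equivalence X x X x f"
      using f by (auto simp: based_homotopy_equivalence_def map_class_eq_iff
          based_maps_compose id_in_based_maps)
    finally show ?thesis .
  qed
  show ?thesis
  proof (intro equalityI subsetI)
    fix F assume "F \<in> self_equivalences X x"
    then obtain f where f: "based_homotopy_equivalence X x X x f" and F: "F = map_class X x f"
      unfolding self_equivalences_def by (auto elim: quotientE)
    then show "F \<in> Units ?M"
      using unit_iff[of f] by (simp add: based_homotopy_equivalence_def)
  next
    fix F assume F: "F \<in> Units ?M"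
    then obtain f where f: "f \<in> based_maps X x X x" "F = map_class X x f"
      by (auto simp: Units_def elim: self_map_monoid_cases)
    with F unit_iff show "F \<in> self_equivalences X x"
      by (auto simp: self_equivalences_def intro!: quotientI)
  qed
qed

lemma self_equivalence_group_eq_units_of:
  "self_equivalence_group X x = units_of (self_map_monoid X x)"
  by (simp add: self_equivalence_group_def units_of_def self_equivalences_eq_Units
      self_map_monoid_def)

lemma group_self_equivalence_group: "group (self_equivalence_group X x)"
  unfolding self_equivalence_group_eq_units_of
  by (rule monoid.units_group[OF monoid_self_map_monoid])

section \<open>Induced maps of homotopy groups\<close>

lemma equiv_cube_homotopy_rel: "equiv (cube_maps i X x) (cube_homotopy_rel i X x)"
proof (rule equivI)
  show "cube_homotopy_rel i X x \<subseteq> cube_maps i X x \<times> cube_maps i X x"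
    by (auto simp: cube_homotopy_rel_def cube_maps_def
        dest: homotopic_with_imp_continuous_maps homotopic_with_imp_property)
  show "refl_on (cube_maps i X x) (cube_homotopy_rel i X x)"
    by (auto simp: refl_on_def cube_homotopy_rel_def cube_maps_def)
  show "sym (cube_homotopy_rel i X x)"
    by (auto simp: sym_def cube_homotopy_rel_def intro: homotopic_with_symD)
  show "trans (cube_homotopy_rel i X x)"
    by (auto simp: trans_def cube_homotopy_rel_def elim: homotopic_with_trans)
qed

lemma cube_maps_compose:
  "f \<in> based_maps X x Y y \<Longrightarrow> h \<in> cube_maps i X x \<Longrightarrow> f \<circ> h \<in> cube_maps i Y y"
  by (auto simp: based_maps_def cube_maps_def intro: continuous_map_compose)

lemma cube_homotopy_rel_compose:
  assumes ff': "(f, f') \<in> based_homotopy_rel X x Y y"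
    and hh': "(h, h') \<in> cube_homotopy_rel i X x"
  shows "(f \<circ> h, f' \<circ> h') \<in> cube_homotopy_rel i Y y"
proof -
  let ?P = "\<lambda>x h. \<forall>s \<in> cube_boundary i. h s = x"
  have f: "f \<in> based_maps X x Y y" and h': "h' \<in> cube_maps i X x"
    using subsetD[OF equiv_type[OF equiv_based_homotopy_rel] ff']
      subsetD[OF equiv_type[OF equiv_cube_homotopy_rel] hh'] by auto
  have "homotopic_with (?P y) (cube i) Y (f \<circ> h) (f \<circ> h')"
    by (rule homotopic_with_compose_continuous_map_left[where p = "?P x" and ?X2.0 = X])
       (use f hh' in \<open>auto simp: cube_homotopy_rel_def based_maps_def\<close>)
  moreover have "homotopic_with (?P y) (cube i) Y (f \<circ> h') (f' \<circ> h')"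
    by (rule homotopic_with_compose_continuous_map_right[where p = "\<lambda>h. h x = y" and ?X2.0 = X])
       (use h' ff' in \<open>auto simp: based_homotopy_rel_def based_homotopic_def cube_maps_def\<close>)
  ultimately show ?thesis
    by (auto simp: cube_homotopy_rel_def elim: homotopic_with_trans)
qed

lemma cube_class_in_homotopy_set: "h \<in> cube_maps i X x \<Longrightarrow> cube_class i X x h \<in> homotopy_set i X x"
  by (simp add: homotopy_set_def quotientI)

lemma homotopy_set_cases:
  assumes "c \<in> homotopy_set i X x"
  obtains h where "h \<in> cube_maps i X x" "c = cube_class i X x h"
  using assms unfolding homotopy_set_def by (auto elim: quotientE)

lemma homotopy_induced_class:
  assumes "f \<in> based_maps X x X x" "h \<in> cube_maps i X x"
  shows "homotopy_induced i X x (map_class X x f) (cube_class i X x h) = cube_class i X x (f \<circ> h)"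
proof -
  have "congruent2 (based_homotopy_rel X x X x) (cube_homotopy_rel i X x)
          (\<lambda>f h. cube_class i X x (f \<circ> h))"
    by (rule congruent2I')
       (rule equiv_class_eq[OF equiv_cube_homotopy_rel], rule cube_homotopy_rel_compose)
  from UN_equiv_class2[OF equiv_based_homotopy_rel equiv_cube_homotopy_rel this assms]
  show ?thesis
    using assms by (simp add: homotopy_induced_def cube_class_in_homotopy_set)
qed

lemma homotopy_induced_in_homotopy_set:
  "F \<in> carrier (self_map_monoid X x) \<Longrightarrow> c \<in> homotopy_set i X x \<Longrightarrow>
     homotopy_induced i X x F c \<in> homotopy_set i X x"
  by (auto elim!: self_map_monoid_cases homotopy_set_cases
      simp: homotopy_induced_class intro!: cube_class_in_homotopy_set cube_maps_compose)

lemma homotopy_induced_mult: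
  assumes "F \<in> carrier (self_map_monoid X x)" "G \<in> carrier (self_map_monoid X x)"
    and "c \<in> homotopy_set i X x"
  shows "homotopy_induced i X x (F \<otimes>\<^bsub>self_map_monoid X x\<^esub> G) c =
           homotopy_induced i X x F (homotopy_induced i X x G c)"
  using assms
  by (auto elim!: self_map_monoid_cases homotopy_set_cases
      simp: homotopy_induced_class map_class_mult cube_maps_compose based_maps_compose comp_assoc)

lemma homotopy_induced_one:
  "c \<in> homotopy_set i X x \<Longrightarrow> homotopy_induced i X x \<one>\<^bsub>self_map_monoid X x\<^esub> c = c"
  by (auto elim!: homotopy_set_cases
      simp: homotopy_induced_class map_class_one id_in_based_maps)

text \<open>
  Induced maps are extensional on the homotopy set. Equality of induced maps as HOL functions,
  which is what \<open>A_sharp_rel\<close> demands, is therefore the same as equality on homotopy classes.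
\<close>

lemma homotopy_induced_extensional: "homotopy_induced i X x F \<in> extensional (homotopy_set i X x)"
  by (simp add: homotopy_induced_def)

lemma homotopy_induced_eqI:
  "(\<And>c. c \<in> homotopy_set i X x \<Longrightarrow> homotopy_induced i X x F c = homotopy_induced i X x G c) \<Longrightarrow>
     homotopy_induced i X x F = homotopy_induced i X x G"
  by (rule extensionalityI[where A = "homotopy_set i X x"]) (simp_all add: homotopy_induced_extensional)

section \<open>Concatenation of cubes\<close>

lemma topspace_cube: "topspace (cube n) = {s. (\<forall>i\<ge>n. s i = 0) \<and> (\<forall>i<n. 0 \<le> s i \<and> s i \<le> 1)}"
  by (auto simp: cube_def topspace_Euclidean_space)

lemma cube_boundaryI:
  "s \<in> topspace (cube n) \<Longrightarrow> i < n \<Longrightarrow> s i = 0 \<or> s i = 1 \<Longrightarrow> s \<in> cube_boundary n"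
  by (auto simp: cube_boundary_def)

lemma continuous_map_into_cube:
  "continuous_map Z (cube n) f \<longleftrightarrow>
     (\<forall>i. continuous_map Z euclideanreal (\<lambda>z. f z i)) \<and> f \<in> topspace Z \<rightarrow> topspace (cube n)"
  by (auto simp: cube_def Euclidean_space_def continuous_map_in_subtopology
      continuous_map_componentwise_UNIV Pi_iff)

lemma continuous_map_cube_component:
  "continuous_map (cube n) euclideanreal (\<lambda>s. s i)"
  using continuous_map_into_cube[of "cube n" n "\<lambda>s. s"] by auto

text \<open>
  The halves of a concatenation agree on the common face \<open>s 0 = 1/2\<close>, since both are constant on
  the boundary of the cube. The parameter space \<open>T\<close> is the unit interval when homotopies are
  concatenated.
\<close>

lemma continuous_map_cube_concat:
  assumes n: "n > 0"
    and H: "continuous_map (prod_topology T (cube n)) X H"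
    and K: "continuous_map (prod_topology T (cube n)) X K"
    and bdry: "\<And>t s. t \<in> topspace T \<Longrightarrow> s \<in> cube_boundary n \<Longrightarrow> H (t, s) = x \<and> K (t, s) = x"
  shows "continuous_map (prod_topology T (cube n)) X
           (\<lambda>(t, s). cube_concat (\<lambda>s. H (t, s)) (\<lambda>s. K (t, s)) s)"
proof -
  let ?Z = "prod_topology T (cube n)"
  let ?A = "{z \<in> topspace ?Z. snd z 0 \<le> 1/2}" and ?B = "{z \<in> topspace ?Z. 1/2 \<le> snd z 0}"
  have comp: "continuous_map ?Z euclideanreal (\<lambda>z. snd z i)" for i
    using continuous_map_compose[OF continuous_map_snd continuous_map_cube_component, of T n i]
    by (simp add: o_def)
  \<comment> \<open>One reparametrisation serves both halves: \<open>a = 0\<close> for the first, \<open>a = 1\<close> for the second.\<close>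
  have scaled: "continuous_map (subtopology ?Z S) ?Z (\<lambda>z. (fst z, (snd z)(0 := 2 * snd z 0 - a)))"
    if S: "\<And>z. z \<in> topspace ?Z \<Longrightarrow> z \<in> S \<Longrightarrow> a \<le> 2 * snd z 0 \<and> 2 * snd z 0 \<le> 1 + a" for a S
  proof (intro continuous_map_pairedI)
    show "continuous_map (subtopology ?Z S) T fst"
      by (intro continuous_map_from_subtopology continuous_map_fst)
    have "continuous_map ?Z euclideanreal (\<lambda>z. ((snd z)(0 := 2 * snd z 0 - a)) i)" for i
      by (cases "i = 0") (auto intro!: continuous_intros comp)
    moreover have "(snd z)(0 := 2 * snd z 0 - a) \<in> topspace (cube n)"
      if "z \<in> topspace (subtopology ?Z S)" for z
      using that S[of z] n by (auto simp: topspace_cube)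
    ultimately show "continuous_map (subtopology ?Z S) (cube n) (\<lambda>z. (snd z)(0 := 2 * snd z 0 - a))"
      unfolding continuous_map_into_cube
      by (auto intro!: continuous_map_from_subtopology simp del: fun_upd_apply)
  qed
  have "continuous_map ?Z X
          (\<lambda>z. if snd z 0 \<le> 1/2 then (H \<circ> (\<lambda>z. (fst z, (snd z)(0 := 2 * snd z 0 - 0)))) z
               else (K \<circ> (\<lambda>z. (fst z, (snd z)(0 := 2 * snd z 0 - 1)))) z)"
  proof (rule continuous_map_cases_le)
    show "continuous_map ?Z euclideanreal (\<lambda>z. snd z 0)" by (rule comp)
    show "continuous_map ?Z euclideanreal (\<lambda>z. 1/2)" by simp
    show "continuous_map (subtopology ?Z ?A) X (H \<circ> (\<lambda>z. (fst z, (snd z)(0 := 2 * snd z 0 - 0))))"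
      by (rule continuous_map_compose[OF scaled H]) (use n in \<open>auto simp: topspace_cube\<close>)
    show "continuous_map (subtopology ?Z ?B) X (K \<circ> (\<lambda>z. (fst z, (snd z)(0 := 2 * snd z 0 - 1))))"
      by (rule continuous_map_compose[OF scaled K]) (use n in \<open>auto simp: topspace_cube\<close>)
    fix z assume z: "z \<in> topspace ?Z" "snd z 0 = 1/2"
    \<comment> \<open>The new coordinate \<open>0\<close> is \<open>1\<close> for the first half and \<open>0\<close> for the second.\<close>
    have "(snd z)(0 := 2 * snd z 0 - 0) \<in> cube_boundary n"
         "(snd z)(0 := 2 * snd z 0 - 1) \<in> cube_boundary n"
      using z n by (auto intro!: cube_boundaryI[where i = 0] simp: topspace_cube)
    with z bdry
    show "(H \<circ> (\<lambda>z. (fst z, (snd z)(0 := 2 * snd z 0 - 0)))) z =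
          (K \<circ> (\<lambda>z. (fst z, (snd z)(0 := 2 * snd z 0 - 1)))) z"
      by (auto simp: topspace_prod_topology mem_Times_iff)
  qed
  then show ?thesis
    by (simp add: cube_concat_def case_prod_beta' o_def cong: if_cong)
qed

lemma cube_concat_boundary:
  assumes "\<forall>s \<in> cube_boundary n. f s = x" "\<forall>s \<in> cube_boundary n. g s = x"
    and s: "s \<in> cube_boundary n"
  shows "cube_concat f g s = x"
proof -
  from s obtain i where i: "i < n" "s i = 0 \<or> s i = 1" and top: "s \<in> topspace (cube n)"
    by (auto simp: cube_boundary_def)
  have "s(0 := 2 * s 0) \<in> cube_boundary n" if "s 0 \<le> 1/2"
    using that i top by (intro cube_boundaryI[where i = i]) (auto simp: topspace_cube)
  moreover have "s(0 := 2 * s 0 - 1) \<in> cube_boundary n" if "\<not> s 0 \<le> 1/2"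
    using that i top by (intro cube_boundaryI[where i = i]) (auto simp: topspace_cube)
  ultimately show ?thesis
    using assms by (auto simp: cube_concat_def)
qed

lemma cube_homotopy_rel_concat:
  assumes n: "n > 0"
    and f: "(f, f') \<in> cube_homotopy_rel n X x" and g: "(g, g') \<in> cube_homotopy_rel n X x"
  shows "(cube_concat f g, cube_concat f' g') \<in> cube_homotopy_rel n X x"
proof -
  let ?I = "top_of_set {0..1::real}"
  from f obtain H where H: "continuous_map (prod_topology ?I (cube n)) X H"
      "\<forall>s. H (0, s) = f s" "\<forall>s. H (1, s) = f' s"
      "\<forall>t \<in> {0..1}. \<forall>s \<in> cube_boundary n. H (t, s) = x"
    unfolding cube_homotopy_rel_def homotopic_with_def by auto
  from g obtain K where K: "continuous_map (prod_topology ?I (cube n)) X K"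
      "\<forall>s. K (0, s) = g s" "\<forall>s. K (1, s) = g' s"
      "\<forall>t \<in> {0..1}. \<forall>s \<in> cube_boundary n. K (t, s) = x"
    unfolding cube_homotopy_rel_def homotopic_with_def by auto
  let ?L = "\<lambda>(t, s). cube_concat (\<lambda>s. H (t, s)) (\<lambda>s. K (t, s)) s"
  have "continuous_map (prod_topology ?I (cube n)) X ?L"
    by (rule continuous_map_cube_concat[OF n H(1) K(1)]) (use H(4) K(4) in auto)
  moreover have "\<forall>t \<in> {0..1}. \<forall>s \<in> cube_boundary n. ?L (t, s) = x"
    using H(4) K(4) by (auto intro!: cube_concat_boundary)
  moreover have "\<forall>s. ?L (0, s) = cube_concat f g s" "\<forall>s. ?L (1, s) = cube_concat f' g' s"
    using H(2,3) K(2,3) by auto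
  ultimately show ?thesis
    unfolding cube_homotopy_rel_def homotopic_with_def by blast
qed

text \<open>This is the case of constant homotopies in the previous lemma.\<close>

lemma cube_maps_concat:
  assumes "n > 0" "f \<in> cube_maps n X x" "g \<in> cube_maps n X x"
  shows "cube_concat f g \<in> cube_maps n X x"
proof -
  have "(f, f) \<in> cube_homotopy_rel n X x" "(g, g) \<in> cube_homotopy_rel n X x"
    using assms equiv_cube_homotopy_rel[of n X x] by (auto simp: equiv_def refl_on_def)
  from cube_homotopy_rel_concat[OF assms(1) this]
  show ?thesis
    using equiv_cube_homotopy_rel[of n X x] by (auto simp: equiv_def)
qed

lemma homotopy_group_mult:
  assumes "n > 0" "f \<in> cube_maps n X x" "g \<in> cube_maps n X x"
  shows "cube_class n X x f \<otimes>\<^bsub>homotopy_group n X x\<^esub> cube_class n X x g =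
           cube_class n X x (cube_concat f g)"
proof -
  have "congruent2 (cube_homotopy_rel n X x) (cube_homotopy_rel n X x)
          (\<lambda>f g. cube_class n X x (cube_concat f g))"
    by (rule congruent2I')
       (rule equiv_class_eq[OF equiv_cube_homotopy_rel], rule cube_homotopy_rel_concat[OF assms(1)])
  from UN_equiv_class2[OF equiv_cube_homotopy_rel equiv_cube_homotopy_rel this assms(2,3)]
  show ?thesis by (simp add: homotopy_group_def)
qed

lemma comp_cube_concat: "f \<circ> cube_concat g h = cube_concat (f \<circ> g) (f \<circ> h)"
  by (auto simp: cube_concat_def)

lemma homotopy_induced_hom:
  assumes n: "n > 0" and F: "F \<in> carrier (self_map_monoid X x)"
  shows "homotopy_induced n X x F \<in> hom (homotopy_group n X x) (homotopy_group n X x)"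
proof (rule homI)
  let ?G = "homotopy_group n X x"
  have [simp]: "carrier ?G = homotopy_set n X x" by (simp add: homotopy_group_def)
  show "homotopy_induced n X x F c \<in> carrier ?G" if "c \<in> carrier ?G" for c
    using that F by (simp add: homotopy_induced_in_homotopy_set)
  show "homotopy_induced n X x F (c \<otimes>\<^bsub>?G\<^esub> d) =
          homotopy_induced n X x F c \<otimes>\<^bsub>?G\<^esub> homotopy_induced n X x F d"
    if "c \<in> carrier ?G" "d \<in> carrier ?G" for c d
    using that F n
    by (auto elim!: self_map_monoid_cases homotopy_set_cases
        simp: homotopy_induced_class homotopy_group_mult cube_maps_concat cube_maps_compose
          comp_cube_concat)
qed

text \<open>
  The definition of an induced isomorphism distinguishes the set in degree \<open>0\<close> from the groups in
  positive degrees. For maps induced by self-maps this distinction disappears, so that later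
  arguments treat all degrees alike.
\<close>

lemma homotopy_induced_iso_iff_bij_betw:
  assumes "F \<in> carrier (self_map_monoid X x)"
  shows "homotopy_induced_iso i X x F \<longleftrightarrow>
           bij_betw (homotopy_induced i X x F) (homotopy_set i X x) (homotopy_set i X x)"
  using homotopy_induced_hom[OF _ assms, of i]
  by (auto simp: homotopy_induced_iso_def iso_def) (auto simp: homotopy_group_def)

section \<open>Self-maps inducing isomorphisms up to degree n\<close>

lemma A_sharp_iff:
  "F \<in> A_sharp n X x \<longleftrightarrow> F \<in> carrier (self_map_monoid X x) \<and>
     (\<forall>i\<le>n. bij_betw (homotopy_induced i X x F) (homotopy_set i X x) (homotopy_set i X x))"
  by (auto simp: A_sharp_def homotopy_induced_iso_iff_bij_betw)

lemma A_sharp_subset_carrier: "A_sharp n X x \<subseteq> carrier (self_map_monoid X x)"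
  by (auto simp: A_sharp_def)

lemma A_sharp_mult:
  assumes "F \<in> A_sharp n X x" "G \<in> A_sharp n X x"
  shows "F \<otimes>\<^bsub>self_map_monoid X x\<^esub> G \<in> A_sharp n X x"
proof -
  interpret monoid "self_map_monoid X x" by (rule monoid_self_map_monoid)
  have "bij_betw (homotopy_induced i X x (F \<otimes>\<^bsub>self_map_monoid X x\<^esub> G))
          (homotopy_set i X x) (homotopy_set i X x)" if "i \<le> n" for i
  proof -
    have "bij_betw (homotopy_induced i X x F \<circ> homotopy_induced i X x G)
            (homotopy_set i X x) (homotopy_set i X x)"
      using assms that by (auto simp: A_sharp_iff intro: bij_betw_trans)
    then show ?thesis
      by (rule bij_betw_cong[THEN iffD1, rotated])
         (use assms in \<open>simp add: A_sharp_iff homotopy_induced_mult\<close>)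
  qed
  with assms show ?thesis by (auto simp: A_sharp_iff)
qed

text \<open>By functoriality, an inverse of \<open>F\<close> induces inverses of the maps induced by \<open>F\<close>.\<close>

lemma self_equivalences_subset_A_sharp: "self_equivalences X x \<subseteq> A_sharp n X x"
proof
  let ?M = "self_map_monoid X x"
  interpret monoid ?M by (rule monoid_self_map_monoid)
  fix F assume "F \<in> self_equivalences X x"
  then obtain G where F: "F \<in> carrier ?M" and G: "G \<in> carrier ?M"
    and inv: "G \<otimes>\<^bsub>?M\<^esub> F = \<one>\<^bsub>?M\<^esub>" "F \<otimes>\<^bsub>?M\<^esub> G = \<one>\<^bsub>?M\<^esub>"
    by (auto simp: self_equivalences_eq_Units Units_def)
  have "bij_betw (homotopy_induced i X x F) (homotopy_set i X x) (homotopy_set i X x)" for i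
    by (rule bij_betw_byWitness[where f' = "homotopy_induced i X x G"])
       (use F G inv in \<open>auto simp: homotopy_induced_in_homotopy_set homotopy_induced_one
          simp flip: homotopy_induced_mult\<close>)
  with F show "F \<in> A_sharp n X x" by (simp add: A_sharp_iff)
qed

lemma equiv_A_sharp_rel: "equiv (A_sharp n X x) (A_sharp_rel n X x)"
  by (rule equivI) (auto simp: A_sharp_rel_def refl_on_def sym_def trans_def)

lemma A_sharp_rel_mult:
  assumes "(F, F') \<in> A_sharp_rel n X x" "(G, G') \<in> A_sharp_rel n X x"
  shows "(F \<otimes>\<^bsub>self_map_monoid X x\<^esub> G, F' \<otimes>\<^bsub>self_map_monoid X x\<^esub> G') \<in> A_sharp_rel n X x"
  using assms
  by (auto simp: A_sharp_rel_def A_sharp_mult A_sharp_subset_carrier[THEN subsetD]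
      homotopy_induced_mult homotopy_induced_in_homotopy_set intro!: homotopy_induced_eqI)

lemma A_sharp_bar_mult:
  assumes "F \<in> A_sharp n X x" "G \<in> A_sharp n X x"
  shows "A_sharp_rel n X x `` {F} \<otimes>\<^bsub>A_sharp_bar n X x\<^esub> A_sharp_rel n X x `` {G} =
           A_sharp_rel n X x `` {F \<otimes>\<^bsub>self_map_monoid X x\<^esub> G}"
proof -
  have "congruent2 (A_sharp_rel n X x) (A_sharp_rel n X x)
          (\<lambda>F G. A_sharp_rel n X x `` {F \<otimes>\<^bsub>self_map_monoid X x\<^esub> G})"
    by (rule congruent2I') (rule equiv_class_eq[OF equiv_A_sharp_rel], rule A_sharp_rel_mult)
  from UN_equiv_class2[OF equiv_A_sharp_rel equiv_A_sharp_rel this assms]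
  show ?thesis by (simp add: A_sharp_bar_def)
qed

section \<open>The homomorphism from self-equivalences\<close>

abbreviation bar_map ::
    "nat \<Rightarrow> 'a topology \<Rightarrow> 'a \<Rightarrow> ('a \<Rightarrow> 'a) set \<Rightarrow> ('a \<Rightarrow> 'a) set set" where
  "bar_map n X x \<equiv> \<lambda>F. A_sharp_rel n X x `` {F}"

lemma carrier_self_equivalence_group: "carrier (self_equivalence_group X x) = self_equivalences X x"
  by (simp add: self_equivalence_group_def)

lemma bar_map_hom: "bar_map n X x \<in> hom (self_equivalence_group X x) (A_sharp_bar n X x)"
proof (rule homI)
  let ?E = "self_equivalence_group X x"
  have sub: "F \<in> A_sharp n X x" if "F \<in> carrier ?E" for F
    using that self_equivalences_subset_A_sharp[of X x n]
    by (auto simp: carrier_self_equivalence_group)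
  show "bar_map n X x F \<in> carrier (A_sharp_bar n X x)" if "F \<in> carrier ?E" for F
    using sub[OF that] by (simp add: A_sharp_bar_def quotientI)
  show "bar_map n X x (F \<otimes>\<^bsub>?E\<^esub> G) = bar_map n X x F \<otimes>\<^bsub>A_sharp_bar n X x\<^esub> bar_map n X x G"
    if "F \<in> carrier ?E" "G \<in> carrier ?E" for F G
    using sub that by (simp add: A_sharp_bar_mult) (simp add: self_equivalence_group_def)
qed

lemma bar_map_one: "bar_map n X x \<one>\<^bsub>self_equivalence_group X x\<^esub> = \<one>\<^bsub>A_sharp_bar n X x\<^esub>"
  by (simp add: A_sharp_bar_def self_equivalence_group_def)

text \<open>
  The class of \<open>F\<close> is trivial iff \<open>F\<close> induces the same maps as the identity class, which acts
  as the identity on homotopy classes of cubes.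
\<close>

lemma kernel_bar_map:
  "kernel (self_equivalence_group X x) (A_sharp_bar n X x) (bar_map n X x) = E_sharp n X x"
proof -
  let ?one = "\<one>\<^bsub>self_map_monoid X x\<^esub>"
  interpret monoid "self_map_monoid X x" by (rule monoid_self_map_monoid)
  have "?one \<in> A_sharp n X x"
    using self_equivalences_subset_A_sharp[of X x n] by (auto simp: self_equivalences_eq_Units)
  then have "bar_map n X x F = bar_map n X x ?one \<longleftrightarrow>
      (\<forall>i\<le>n. homotopy_induced i X x F = homotopy_induced i X x ?one)"
    if "F \<in> self_equivalences X x" for F
    using that self_equivalences_subset_A_sharp[of X x n]
    by (auto simp: eq_equiv_class_iff[OF equiv_A_sharp_rel] A_sharp_rel_def subset_iff)
  moreover have "homotopy_induced i X x F = homotopy_induced i X x ?one \<longleftrightarrow>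
      (\<forall>c \<in> homotopy_set i X x. homotopy_induced i X x F c = c)" for i F
    using homotopy_induced_eqI[of i X x F ?one] by (auto simp: homotopy_induced_one)
  ultimately show ?thesis
    by (auto simp: kernel_def E_sharp_def carrier_self_equivalence_group A_sharp_bar_def)
qed

lemma A_sharp_self_closeness_number:
  assumes "self_closeness_number X x = enat n"
  shows "A_sharp n X x = self_equivalences X x"
proof -
  have ex: "\<exists>k. A_sharp k X x = self_equivalences X x"
    and n: "n = (LEAST k. A_sharp k X x = self_equivalences X x)"
    using assms by (auto simp: self_closeness_number_def split: if_splits)
  show ?thesis unfolding n by (rule LeastI_ex[OF ex])
qed

theorem theorem6:
  fixes X :: "'a topology" and x :: 'a and Y :: "'b topology" and y :: 'b and n :: nat
  assumes "x \<in> topspace X"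
    and "connected_space X"
    and "CW_complex Y" and "y \<in> topspace Y"
    and "based_homotopy_equivalent X x Y y"
    and "n > 0"
  shows "(\<exists>H. submonoid H (A_sharp_bar n X x) \<and>
              group ((A_sharp_bar n X x)\<lparr>carrier := H\<rparr>) \<and>
              self_equivalence_group X x Mod E_sharp n X x \<cong> (A_sharp_bar n X x)\<lparr>carrier := H\<rparr>)
       \<and> (self_closeness_number X x = enat n \<longrightarrow>
            A_sharp_bar n X x \<cong> self_equivalence_group X x Mod E_sharp n X x)"
proof -
  let ?E = "self_equivalence_group X x" and ?A = "A_sharp_bar n X x" and ?b = "bar_map n X x"
  interpret E: group ?E by (rule group_self_equivalence_group)
  define H where "H = ?b ` carrier ?E"
  let ?H = "?A\<lparr>carrier := H\<rparr>"
  have "group (?A\<lparr>carrier := ?b ` carrier ?E, one := ?b \<one>\<^bsub>?E\<^esub>\<rparr>)"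
    by (rule E.hom_imp_img_group[OF bar_map_hom])
  then have group_H: "group ?H"
    by (simp add: bar_map_one H_def)
  interpret b: group_hom ?E ?H ?b
    using bar_map_hom[of n X x] group_H
    by (auto simp: group_hom_def group_hom_axioms_def hom_def H_def E.group_axioms)
  have "submonoid H ?A"
  proof
    show "H \<subseteq> carrier ?A"
      using bar_map_hom[of n X x] by (auto simp: H_def hom_def)
    show "a \<otimes>\<^bsub>?A\<^esub> c \<in> H" if "a \<in> H" "c \<in> H" for a c
      using b.H.m_closed that by simp
    show "\<one>\<^bsub>?A\<^esub> \<in> H"
      using b.H.one_closed by simp
  qed
  moreover have "kernel ?E ?H ?b = E_sharp n X x"
    using kernel_bar_map[of X x n] by (simp add: kernel_def)
  then have iso: "?E Mod E_sharp n X x \<cong> ?H" and normal: "E_sharp n X x \<lhd> ?E"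
    using b.FactGroup_iso b.normal_kernel by (simp_all add: H_def)
  moreover have "?A \<cong> ?E Mod E_sharp n X x" if "self_closeness_number X x = enat n"
  proof -
    have "H = carrier ?A"
      using A_sharp_self_closeness_number[OF that]
      by (auto simp: H_def A_sharp_bar_def carrier_self_equivalence_group quotient_def)
    then have "?H = ?A" by simp
    with group.iso_sym[OF normal.factorgroup_is_group[OF normal] iso] show ?thesis by simp
  qed
  ultimately show ?thesis using group_H by blast
qed

end
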